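(* Let $\mathcal{H}$ be a complex Hilbert space and let $U$ be a unitary operator on $\mathcal{H}$. For any fixed $x,y\in\mathcal{H}$, the sequence of functionals $F^N_{x,y}$ on $C(T)$, defined by $$F^N_{x,y}(f)=\frac{1}{N+1}\,\frac{1}{2\pi}\int_{[0,2\pi)}\langle T_N(t)x,T_N(t)y\rangle f(e^{it})\,dt,\qquad T_N(t)=\sum_{n=0}^N e^{-itn}U^n,$$ converges in the weak-$\ast$ topology, as $N\to\infty$, to a complex Borel measure; that is, there is a complex Borel measure $\mu_{x,y}$ on $[0,2\pi)$ such that for every $f\in C(T)$ $$\lim_{N\to\infty}F^N_{x,y}(f)=\int_{[0,2\pi)}f(e^{it})\,\mu_{x,y}(dt).$$
   Context: $\langle\cdot,\cdot\rangle$ denotes the inner product of $\mathcal{H}$, linear in the first variable and conjugate-linear in the second. $T$ denotes the unit circle in $\mathbb{C}$, and $C(T)$ is the Banach space of complex continuous functions on $T$ with the supremum norm $\|\cdot\|_\infty$. *)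

theory Defs
  imports "HOL-Probability.Probability"
begin

class complex_inner = real_normed_vector +
  fixes scaleC :: "complex \<Rightarrow> 'a \<Rightarrow> 'a" (infixr "*\<^sub>C" 75)
    and cinner :: "'a \<Rightarrow> 'a \<Rightarrow> complex"
  assumes scaleR_scaleC: "r *\<^sub>R x = complex_of_real r *\<^sub>C x"
    and scaleC_add_right: "a *\<^sub>C (x + y) = a *\<^sub>C x + a *\<^sub>C y"
    and scaleC_add_left: "(a + b) *\<^sub>C x = a *\<^sub>C x + b *\<^sub>C x"
    and scaleC_scaleC: "a *\<^sub>C b *\<^sub>C x = (a * b) *\<^sub>C x"
    and scaleC_one: "1 *\<^sub>C x = x"
    and cinner_commute: "cinner x y = cnj (cinner y x)"
    and cinner_add_left: "cinner (x + y) z = cinner x z + cinner y z"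
    and cinner_scaleC_left: "cinner (a *\<^sub>C x) y = a * cinner x y"
    and cinner_ge_zero: "0 \<le> Re (cinner x x)"
    and cinner_eq_zero_iff: "cinner x x = 0 \<longleftrightarrow> x = 0"
    and norm_eq_sqrt_cinner: "norm x = sqrt (Re (cinner x x))"

class chilbert_space = complex_inner + banach

instantiation complex :: chilbert_space
begin

definition scaleC_complex :: "complex \<Rightarrow> complex \<Rightarrow> complex"
  where "scaleC_complex a x = a * x"

definition cinner_complex :: "complex \<Rightarrow> complex \<Rightarrow> complex"
  where "cinner_complex x y = x * cnj y"

instance
  by standard
    (auto simp: scaleC_complex_def cinner_complex_def scaleR_conv_of_real
      algebra_simps norm_complex_def power2_eq_square)

end

definition clinear_op :: "('a::complex_inner \<Rightarrow> 'b::complex_inner) \<Rightarrow> bool" where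
  "clinear_op U \<longleftrightarrow>
     (\<forall>x y. U (x + y) = U x + U y) \<and> (\<forall>c x. U (c *\<^sub>C x) = c *\<^sub>C U x)"

definition unitary_op :: "('a::chilbert_space \<Rightarrow> 'a) \<Rightarrow> bool" where
  "unitary_op U \<longleftrightarrow>
     clinear_op U \<and> surj U \<and> (\<forall>x y. cinner (U x) (U y) = cinner x y)"

text \<open>A complex measure is a countably additive complex-valued set function. The measure
  \<open>M\<close> only supplies the underlying \<open>\<sigma>\<close>-algebra \<open>sets M\<close>; its own values are irrelevant,
  and so are the values of \<open>\<mu>\<close> outside \<open>sets M\<close>.\<close>

definition complex_measure :: "'a measure \<Rightarrow> ('a set \<Rightarrow> complex) \<Rightarrow> bool" where
  "complex_measure M \<mu> \<longleftrightarrow>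
     \<mu> {} = 0 \<and>
     (\<forall>A::nat \<Rightarrow> 'a set. range A \<subseteq> sets M \<longrightarrow> disjoint_family A \<longrightarrow>
        (\<lambda>i. \<mu> (A i)) sums \<mu> (\<Union>i. A i))"

text \<open>The positive part \<open>\<nu>\<^sup>+\<close> in the Jordan decomposition of a finite signed measure \<open>\<nu>\<close>,
  \<open>\<nu>\<^sup>+(A) = sup {\<nu>(B) | B \<subseteq> A measurable}\<close>. Since \<open>ennreal\<close> sends negative reals to \<open>0 = \<nu>({})\<close>,
  it does not affect the supremum. The negative part of \<open>\<nu>\<close> is the positive part of \<open>-\<nu>\<close>.\<close>

definition jordan_pos :: "'a measure \<Rightarrow> ('a set \<Rightarrow> real) \<Rightarrow> 'a measure" where
  "jordan_pos M \<nu> =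
     measure_of (space M) (sets M) (\<lambda>A. SUP B\<in>{B \<in> sets M. B \<subseteq> A}. ennreal (\<nu> B))"

definition signed_integral :: "'a measure \<Rightarrow> ('a set \<Rightarrow> real) \<Rightarrow> ('a \<Rightarrow> complex) \<Rightarrow> complex" where
  "signed_integral M \<nu> f =
     (LINT x|jordan_pos M \<nu>. f x) - (LINT x|jordan_pos M (\<lambda>A. - \<nu> A). f x)"

definition complex_measure_integral ::
    "'a measure \<Rightarrow> ('a set \<Rightarrow> complex) \<Rightarrow> ('a \<Rightarrow> complex) \<Rightarrow> complex" where
  "complex_measure_integral M \<mu> f =
     signed_integral M (\<lambda>A. Re (\<mu> A)) f + \<i> * signed_integral M (\<lambda>A. Im (\<mu> A)) f"

definition T_op :: "('a::complex_inner \<Rightarrow> 'a) \<Rightarrow> nat \<Rightarrow> real \<Rightarrow> 'a \<Rightarrow> 'a" where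
  "T_op U N t x = (\<Sum>n=0..N. exp (- \<i> * of_real t * of_nat n) *\<^sub>C (U ^^ n) x)"

definition F_functional ::
    "('a::complex_inner \<Rightarrow> 'a) \<Rightarrow> 'a \<Rightarrow> 'a \<Rightarrow> nat \<Rightarrow> (complex \<Rightarrow> complex) \<Rightarrow> complex" where
  "F_functional U x y N f =
     1 / (of_nat N + 1) * (1 / (2 * of_real pi)) *
     (LINT t:{0..<2*pi}|lborel.
        cinner (T_op U N t x) (T_op U N t y) * f (exp (\<i> * of_real t)))"

end

theory Submission imports Defs begin

text \<open>
  The diagonal functionals \<open>F\<^sup>N\<^sub>x\<^sub>,\<^sub>x\<close> are positive, because \<open>\<langle>T\<^sub>N(t) x, T\<^sub>N(t) x\<rangle> \<ge> 0\<close>,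
  and unitarity makes their Fourier coefficients explicit: on the character \<open>e\<^sup>i\<^sup>k\<^sup>t\<close> the
  functional takes the value \<open>(1 - \<bar>k\<bar> / (N + 1)) \<langle>U\<^sup>k x, x\<rangle>\<close> for \<open>\<bar>k\<bar> \<le> N\<close>
  (\<open>integral_cinner_T_op_character\<close>). In particular the mass \<open>\<parallel>x\<parallel>\<^sup>2\<close> does not depend on \<open>N\<close>, and
  every trigonometric polynomial has a limit. Bounded mass and the density of trigonometric
  polynomials extend this to all continuous functions. A measure that represents the limit comes from
  Helly's selection theorem: all densities live on \<open>[0, 2\<pi>)\<close>, so a subsequence
  converges weakly, and its limit must agree with the limit of the whole sequence
  (\<open>weak_limit_of_densities\<close>, \<open>positive_spectral_measure\<close>).

  The general case follows by polarization: \<open>F\<^sup>N\<^sub>x\<^sub>,\<^sub>y\<close> is a combination of four diagonal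
  functionals, so \<open>\<mu>\<close> is the same combination of four finite positive measures. Its real and
  imaginary parts are multiples of differences \<open>P - Q\<close> of finite measures. The integral against such a
  difference is defined through its Jordan decomposition, and
  \<open>signed_integral_diff_finite_measures\<close> identifies it with the integral against \<open>P\<close> minus the
  integral against \<open>Q\<close>.
\<close>

section \<open>Integration against a difference of finite measures\<close>

text \<open>The supremum defining \<open>jordan_pos\<close> is attained at \<open>A \<inter> {h \<ge> 0}\<close>: discarding the points
where the density \<open>h\<close> is negative can only increase the value of \<open>\<nu>\<close>. Coercing \<open>h\<close> to
\<^typ>\<open>ennreal\<close> truncates it at \<open>0\<close>, so the right-hand side is the density of \<open>\<nu>\<^sup>+\<close>.\<close>

lemma jordan_pos_eq_density:
  fixes h :: "'a \<Rightarrow> real"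
  assumes sets: "sets S = sets M" and h: "integrable S h"
    and \<nu>: "\<And>A. A \<in> sets M \<Longrightarrow> \<nu> A = (LINT x:A|S. h x)"
  shows "jordan_pos M \<nu> = density S (\<lambda>x. ennreal (h x))"
proof -
  have space: "space M = space S"
    using sets_eq_imp_space_eq[OF sets] by simp
  have [measurable]: "h \<in> borel_measurable S"
    using h by simp
  have eq: "(SUP B\<in>{B \<in> sets M. B \<subseteq> A}. ennreal (\<nu> B)) = emeasure (density S (\<lambda>x. ennreal (h x))) A"
    if "A \<in> sets S" for A
  proof (rule antisym)
    have [measurable]: "A \<in> sets S" by fact
    have em: "emeasure (density S (\<lambda>x. ennreal (h x))) A = (\<integral>\<^sup>+x. ennreal (h x) * indicator A x \<partial>S)"
      by (simp add: emeasure_density)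
    show "(SUP B\<in>{B \<in> sets M. B \<subseteq> A}. ennreal (\<nu> B)) \<le> emeasure (density S (\<lambda>x. ennreal (h x))) A"
    proof (rule SUP_least, clarify)
      fix B assume B: "B \<in> sets M" "B \<subseteq> A"
      then have [measurable]: "B \<in> sets S" by (simp add: sets)
      have int: "integrable S (\<lambda>x. indicator B x * max 0 (h x))"
        using integrable_mult_indicator[of B S "\<lambda>x. max 0 (h x)"] h by simp
      have "\<nu> B = (LINT x|S. indicator B x * h x)"
        using \<nu>[OF B(1)] by (simp add: set_lebesgue_integral_def)
      also have "\<dots> \<le> (LINT x|S. indicator B x * max 0 (h x))"
        using integrable_mult_indicator[of B S h] h int
        by (intro integral_mono) (auto split: split_indicator)
      finally have "ennreal (\<nu> B) \<le> ennreal (LINT x|S. indicator B x * max 0 (h x))"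
        by (rule ennreal_leI)
      also have "\<dots> = (\<integral>\<^sup>+x. ennreal (indicator B x * max 0 (h x)) \<partial>S)"
        using int by (intro nn_integral_eq_integral[symmetric]) auto
      also have "\<dots> \<le> (\<integral>\<^sup>+x. ennreal (h x) * indicator A x \<partial>S)"
        using B(2) by (intro nn_integral_mono) (auto split: split_indicator simp: max_def ennreal_neg)
      finally show "ennreal (\<nu> B) \<le> emeasure (density S (\<lambda>x. ennreal (h x))) A"
        by (simp add: em)
    qed
    define B where "B = {x \<in> space S. 0 \<le> h x} \<inter> A"
    have [measurable]: "B \<in> sets S" unfolding B_def by measurable
    have "emeasure (density S (\<lambda>x. ennreal (h x))) A = (\<integral>\<^sup>+x. ennreal (indicator B x * h x) \<partial>S)"
      unfolding em B_def by (intro nn_integral_cong) (auto split: split_indicator simp: ennreal_neg)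
    also have "\<dots> = ennreal (LINT x|S. indicator B x * h x)"
      using integrable_mult_indicator[of B S h] h
      by (intro nn_integral_eq_integral) (auto simp: B_def split: split_indicator)
    also have "\<dots> = ennreal (\<nu> B)"
      using \<nu>[of B] \<open>B \<in> sets S\<close> by (simp add: set_lebesgue_integral_def sets)
    also have "\<dots> \<le> (SUP B\<in>{B \<in> sets M. B \<subseteq> A}. ennreal (\<nu> B))"
      by (intro SUP_upper) (auto simp: sets[symmetric] B_def)
    finally show "emeasure (density S (\<lambda>x. ennreal (h x))) A \<le> (SUP B\<in>{B \<in> sets M. B \<subseteq> A}. ennreal (\<nu> B))" .
  qed
  have "jordan_pos M \<nu> = measure_of (space S) (sets S) (emeasure (density S (\<lambda>x. ennreal (h x))))"
    unfolding jordan_pos_def space sets[symmetric]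
    by (intro measure_of_eq) (auto simp: sets.space_closed sets.sigma_sets_eq eq[unfolded sets[symmetric]])
  also have "\<dots> = density S (\<lambda>x. ennreal (h x))"
    using measure_of_of_measure[of "density S (\<lambda>x. ennreal (h x))"] by simp
  finally show ?thesis .
qed

lemma integral_jordan_pos:
  fixes h :: "'a \<Rightarrow> real" and f :: "'a \<Rightarrow> complex"
  assumes sets: "sets S = sets M" and h: "integrable S h"
    and \<nu>: "\<And>A. A \<in> sets M \<Longrightarrow> \<nu> A = (LINT x:A|S. h x)"
    and f: "f \<in> borel_measurable S"
  shows "(LINT x|jordan_pos M \<nu>. f x) = (LINT x|S. max 0 (h x) *\<^sub>R f x)"
proof -
  have [measurable]: "h \<in> borel_measurable S"
    using h by simp
  have "ennreal (max 0 (h x)) = ennreal (h x)" for x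
    by (auto simp: max_def ennreal_neg)
  then have *: "jordan_pos M \<nu> = density S (\<lambda>x. ennreal (max 0 (h x)))"
    using jordan_pos_eq_density[OF sets h] \<nu> by simp
  show ?thesis
    unfolding * using f by (intro integral_density) auto
qed

text \<open>Since \<open>max 0 h - max 0 (- h) = h\<close>, integrating against the two Jordan parts and subtracting
gives back integration against \<open>h\<close>.\<close>

lemma signed_integral_eq_density:
  fixes h :: "'a \<Rightarrow> real" and f :: "'a \<Rightarrow> complex"
  assumes sets: "sets S = sets M" and h: "integrable S h"
    and \<nu>: "\<And>A. A \<in> sets M \<Longrightarrow> \<nu> A = (LINT x:A|S. h x)"
    and f: "f \<in> borel_measurable S" and hf: "integrable S (\<lambda>x. h x *\<^sub>R f x)"
  shows "signed_integral M \<nu> f = (LINT x|S. h x *\<^sub>R f x)"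
proof -
  have [measurable]: "h \<in> borel_measurable S" "f \<in> borel_measurable S"
    using h f by simp_all
  have "integrable S (\<lambda>x. max 0 (h x) *\<^sub>R f x)" "integrable S (\<lambda>x. max 0 (- h x) *\<^sub>R f x)"
    by (rule Bochner_Integration.integrable_bound[OF hf]; auto intro!: mult_right_mono)+
  moreover have "max 0 (h x) *\<^sub>R f x - max 0 (- h x) *\<^sub>R f x = h x *\<^sub>R f x" for x
    by (auto simp: max_def)
  moreover have "(LINT x|jordan_pos M (\<lambda>A. - \<nu> A). f x) = (LINT x|S. max 0 (- h x) *\<^sub>R f x)"
    using h f \<nu> by (intro integral_jordan_pos[OF sets]) (auto simp: set_lebesgue_integral_def)
  moreover have "(LINT x|jordan_pos M \<nu>. f x) = (LINT x|S. max 0 (h x) *\<^sub>R f x)"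
    using \<nu> by (rule integral_jordan_pos[OF sets h _ f])
  ultimately show ?thesis
    by (simp add: signed_integral_def flip: Bochner_Integration.integral_diff)
qed

text \<open>Radon-Nikodym in the form needed below: a finite measure dominated by \<open>S\<close> has a
real-valued integrable density, so that differences of such densities make sense.\<close>

lemma finite_measure_eq_density:
  assumes "finite_measure S" "finite_measure P" and sets: "sets P = sets S"
    and le: "\<And>A. A \<in> sets S \<Longrightarrow> emeasure P A \<le> emeasure S A"
  obtains p :: "'a \<Rightarrow> real" where "p \<in> borel_measurable S" "\<And>x. 0 \<le> p x"
    "integrable S p" "P = density S (\<lambda>x. ennreal (p x))"
    "\<And>A. A \<in> sets S \<Longrightarrow> measure P A = (LINT x:A|S. p x)"
proof -
  interpret S: finite_measure S by fact
  interpret P: finite_measure P by fact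
  have ac: "absolutely_continuous S P"
    unfolding absolutely_continuous_def null_sets_def using le sets by fastforce
  obtain p where p[measurable]: "p \<in> borel_measurable S" and RN: "AE x in S. RN_deriv S P x = ennreal (p x)"
    and nn: "\<And>x. 0 \<le> p x"
    using S.real_RN_deriv[OF P.finite_measure_axioms ac sets] by metis
  have "density S (RN_deriv S P) = density S (\<lambda>x. ennreal (p x))"
    using RN by (intro density_cong) auto
  then have P: "P = density S (\<lambda>x. ennreal (p x))"
    using S.density_RN_deriv[OF ac sets] by simp
  have em: "emeasure P A = (\<integral>\<^sup>+x. ennreal (indicator A x * p x) \<partial>S)" if "A \<in> sets S" for A
    unfolding P using that
    by (subst emeasure_density) (auto intro!: nn_integral_cong split: split_indicator)
  have int: "integrable S p"
  proof (rule integrableI_nonneg)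
    have "(\<integral>\<^sup>+x. ennreal (p x) \<partial>S) = emeasure P (space S)"
      by (subst em) (auto intro!: nn_integral_cong)
    then show "(\<integral>\<^sup>+x. ennreal (p x) \<partial>S) < \<infinity>"
      using P.emeasure_finite[of "space S"] by (metis infinity_ennreal_def less_top)
  qed (use nn in auto)
  have "measure P A = (LINT x:A|S. p x)" if A[measurable]: "A \<in> sets S" for A
  proof -
    have "emeasure P A = ennreal (LINT x|S. indicator A x * p x)"
      unfolding em[OF A] using integrable_mult_indicator[OF A int] nn
      by (intro nn_integral_eq_integral) auto
    moreover have "0 \<le> (LINT x|S. indicator A x * p x)"
      using nn by (intro integral_nonneg_AE) auto
    ultimately show ?thesis
      by (simp add: measure_def set_lebesgue_integral_def)
  qed
  with p nn int P show ?thesis by (rule that)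
qed

text \<open>The Jordan decomposition is minimal, so \<open>P\<close> and \<open>Q\<close> need not be the Jordan parts of
\<open>P - Q\<close>; but the integral depends on the difference only. Both measures have densities with
respect to their lattice supremum, and there the claim is the linearity of the integral in the
density.\<close>

lemma signed_integral_diff_finite_measures:
  fixes f :: "'a \<Rightarrow> complex"
  assumes P: "finite_measure P" "sets P = sets M" and Q: "finite_measure Q" "sets Q = sets M"
    and \<nu>: "\<And>A. A \<in> sets M \<Longrightarrow> \<nu> A = c * (measure P A - measure Q A)"
    and f: "f \<in> borel_measurable M" and bdd: "\<And>x. x \<in> space M \<Longrightarrow> norm (f x) \<le> B"
  shows "signed_integral M \<nu> f = c *\<^sub>R ((LINT x|P. f x) - (LINT x|Q. f x))"
proof -
  interpret P: finite_measure P by fact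
  interpret Q: finite_measure Q by fact
  define S where "S = sup P Q"
  have sets: "sets S = sets M"
    unfolding S_def by (rule sets_sup) fact+
  have space: "space P = space M" "space Q = space M" "space S = space M"
    using P Q sets sets_eq_imp_space_eq by blast+
  have S': "S = sup_measure' P Q"
    using P Q space by (simp add: S_def sup_measure_def sup_lexord_def)
  have le: "emeasure P A \<le> emeasure S A" "emeasure Q A \<le> emeasure S A" if "A \<in> sets S" for A
    using that P Q sets unfolding S'
    by (auto intro!: le_emeasure_sup_measure'1 le_emeasure_sup_measure'2)
  \<comment> \<open>The supremum is bounded by the sum, hence finite.\<close>
  have "emeasure S (space S) \<le> emeasure P (space M) + emeasure Q (space M)"
    unfolding S' using P Q space sets S'
    by (subst emeasure_sup_measure') (auto intro!: SUP_least add_mono emeasure_mono sets.sets_into_space)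
  then have "finite_measure S"
    using P.emeasure_finite[of "space M"] Q.emeasure_finite[of "space M"]
    by (intro finite_measureI) (auto simp: top_unique)
  obtain p where p: "p \<in> borel_measurable S" "\<And>x. 0 \<le> p x"
    "integrable S p" "P = density S (\<lambda>x. ennreal (p x))"
    "\<And>A. A \<in> sets S \<Longrightarrow> measure P A = (LINT x:A|S. p x)"
    by (rule finite_measure_eq_density[OF \<open>finite_measure S\<close> P(1)]) (use P sets le in auto)
  obtain q where q: "q \<in> borel_measurable S" "\<And>x. 0 \<le> q x"
    "integrable S q" "Q = density S (\<lambda>x. ennreal (q x))"
    "\<And>A. A \<in> sets S \<Longrightarrow> measure Q A = (LINT x:A|S. q x)"
    by (rule finite_measure_eq_density[OF \<open>finite_measure S\<close> Q(1)]) (use Q sets le in auto)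
  have fS: "f \<in> borel_measurable S" and fP: "f \<in> borel_measurable P" and fQ: "f \<in> borel_measurable Q"
    using f by (simp_all add: measurable_cong_sets[OF sets refl] measurable_cong_sets[OF P(2) refl] measurable_cong_sets[OF Q(2) refl])
  have "integrable P f" "integrable Q f"
    using bdd space fP fQ
    by (auto intro!: P.integrable_const_bound[where B=B] Q.integrable_const_bound[where B=B])
  then have pf: "integrable S (\<lambda>x. p x *\<^sub>R f x)" and qf: "integrable S (\<lambda>x. q x *\<^sub>R f x)"
    using p(1,2) q(1,2) fS unfolding p(4) q(4) by (simp_all add: integrable_density)
  have Pf: "(LINT x|P. f x) = (LINT x|S. p x *\<^sub>R f x)" and Qf: "(LINT x|Q. f x) = (LINT x|S. q x *\<^sub>R f x)"
    unfolding p(4) q(4) using p(1,2) q(1,2) fS by (simp_all add: integral_density)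
  have split: "(c * (p x - q x)) *\<^sub>R f x = c *\<^sub>R (p x *\<^sub>R f x - q x *\<^sub>R f x)" for x
    by (simp add: algebra_simps)
  have "signed_integral M \<nu> f = (LINT x|S. (c * (p x - q x)) *\<^sub>R f x)"
  proof (rule signed_integral_eq_density[OF sets])
    show "integrable S (\<lambda>x. c * (p x - q x))"
      using p(3) q(3) by auto
    show "integrable S (\<lambda>x. (c * (p x - q x)) *\<^sub>R f x)"
      unfolding split using pf qf by auto
    show "\<nu> A = (LINT x:A|S. c * (p x - q x))" if A: "A \<in> sets M" for A
    proof -
      have "set_integrable S A p" "set_integrable S A q"
        unfolding set_integrable_def using p(3) q(3) A sets by (auto intro: integrable_mult_indicator simp del: real_scaleR_def)
      then show ?thesis
        using \<nu>[OF A] p(5)[of A] q(5)[of A] A sets by simp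
    qed
  qed fact
  also have "\<dots> = c *\<^sub>R ((LINT x|P. f x) - (LINT x|Q. f x))"
    unfolding split Pf Qf using pf qf by simp
  finally show ?thesis .
qed

section \<open>Trigonometric polynomials on the circle\<close>

lemma integral_character:
  "(LINT t:{0..<2*pi}|lborel. cis (of_int k * t)) = (if k = 0 then 2 * of_real pi else 0)"
proof -
  have "(LINT t:{0..<2*pi}|lborel. cis (of_int k * t)) = (LINT t:{0..2*pi}|lborel. cis (of_int k * t))"
    by (rule set_integral_discrete_difference[where X="{2*pi}"]) auto
  also have "\<dots> = (if k = 0 then 2 * of_real pi else 0)"
  proof (cases "k = 0")
    case True
    then show ?thesis by (simp add: set_lebesgue_integral_def scaleR_conv_of_real)
  next
    case False
    define F where "F t = cis (of_int k * t) / (\<i> * of_int k)" for t :: real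
    have "(F has_vector_derivative cis (of_int k * t)) (at t within {0..2*pi})" for t
    proof -
      have "((\<lambda>z. exp (\<i> * of_int k * z) / (\<i> * of_int k)) has_field_derivative exp (\<i> * of_int k * of_real t)) (at (of_real t))"
        using False by (auto intro!: derivative_eq_intros)
      from has_vector_derivative_real_field[OF this] show ?thesis
        by (simp add: F_def[abs_def] cis_conv_exp mult.assoc)
    qed
    then have "(LINT t:{0..2*pi}|lborel. cis (of_int k * t)) = F (2*pi) - F 0"
      unfolding set_lebesgue_integral_def
      by (intro integral_FTC_atLeastAtMost) (auto intro!: continuous_intros)
    also have "\<dots> = 0"
      using cis_multiple_2pi[of "of_int k"] by (simp add: F_def mult.commute)
    finally show ?thesis using False by simp
  qed
  finally show ?thesis .
qed

lemma continuous_on_compose_cis: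
  "continuous_on (sphere 0 1) f \<Longrightarrow> continuous_on A (\<lambda>t. f (cis t))"
  by (rule continuous_on_compose2) (auto intro!: continuous_intros)

lemma set_integrable_circle:
  fixes g :: "real \<Rightarrow> 'b::euclidean_space"
  assumes "continuous_on UNIV g"
  shows "set_integrable lborel {0..<2*pi} g"
proof (rule set_integrable_subset)
  show "set_integrable lborel {0..2*pi} g"
    using assms by (intro borel_integrable_atLeastAtMost') (auto intro: continuous_on_subset)
qed auto

text \<open>Complex trigonometric polynomials as functions of the angle. As an inductive predicate, linear
properties (such as convergence of a sequence of functionals) reduce to the case of a character.\<close>

inductive trig_poly :: "(real \<Rightarrow> complex) \<Rightarrow> bool" where
  character: "trig_poly (\<lambda>t. cis (of_int k * t))"
| add: "trig_poly f \<Longrightarrow> trig_poly g \<Longrightarrow> trig_poly (\<lambda>t. f t + g t)"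
| scale: "trig_poly f \<Longrightarrow> trig_poly (\<lambda>t. c * f t)"

lemma continuous_on_trig_poly: "trig_poly f \<Longrightarrow> continuous_on A f"
  by (induction rule: trig_poly.induct) (auto intro!: continuous_intros)

lemma trig_poly_const: "trig_poly (\<lambda>t. c)"
  using trig_poly.scale[OF trig_poly.character[of 0], of c] by simp

lemma trig_poly_mult: "trig_poly f \<Longrightarrow> trig_poly g \<Longrightarrow> trig_poly (\<lambda>t. f t * g t)"
proof (induction f rule: trig_poly.induct)
  case (character k)
  from character show ?case
  proof (induction g rule: trig_poly.induct)
    case (character l)
    show ?case
      using trig_poly.character[of "k + l"] by (simp add: cis_mult ring_distribs)
  next
    case (add f g)
    then show ?case
      using trig_poly.add by (fastforce simp: ring_distribs)
  next
    case (scale f c)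
    then show ?case
      using trig_poly.scale[OF scale.IH, of c] by (simp add: mult_ac)
  qed
next
  case (add f h)
  then show ?case
    using trig_poly.add by (fastforce simp: ring_distribs)
next
  case (scale f c)
  then show ?case
    using trig_poly.scale[of "\<lambda>t. f t * g t" c] by (simp add: mult_ac)
qed

text \<open>On the circle, \<open>Re z = (z + cnj z) / 2\<close> and \<open>Im z = (z - cnj z) / (2 * \<i>)\<close> with
\<open>cnj (cis t) = cis (- t)\<close>, so every real-linear function of \<open>z\<close> is a trigonometric polynomial
of degree at most one; products do the rest.\<close>

lemma trig_poly_of_real_polynomial:
  fixes p :: "complex \<Rightarrow> real"
  assumes "real_polynomial_function p"
  shows "trig_poly (\<lambda>t. of_real (p (cis t)))"
  using assms
proof (induction rule: real_polynomial_function.induct)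
  case (linear p)
  then interpret bounded_linear p .
  have lin: "p z = Re z * p 1 + Im z * p \<i>" for z
  proof -
    have "p z = p (Re z *\<^sub>R 1 + Im z *\<^sub>R \<i>)"
      by (rule arg_cong[of _ _ p]) (auto simp: complex_eq_iff)
    then show ?thesis by (simp only: add scaleR real_scaleR_def)
  qed
  have "(\<lambda>t. of_real (p (cis t))) = (\<lambda>t. Complex (p 1 / 2) (- p \<i> / 2) * cis (of_int 1 * t)
      + Complex (p 1 / 2) (p \<i> / 2) * cis (of_int (-1) * t))"
    by (subst lin) (simp add: fun_eq_iff complex_eq_iff)
  moreover have "trig_poly \<dots>"
    by (intro trig_poly.intros)
  ultimately show ?case
    by simp
qed (auto intro: trig_poly_const trig_poly.add trig_poly_mult)

text \<open>Stone-Weierstrass on the compact set \<^term>\<open>sphere (0::complex) 1\<close> gives approximation by polynomials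
in \<open>Re z\<close> and \<open>Im z\<close>, which are trigonometric polynomials in the angle.\<close>

lemma trig_poly_dense:
  fixes f :: "complex \<Rightarrow> complex"
  assumes "continuous_on (sphere 0 1) f" and "0 < e"
  obtains h where "trig_poly h" "\<And>t. norm (f (cis t) - h t) < e"
proof -
  obtain p where p: "polynomial_function p" and close: "\<And>z. z \<in> sphere 0 1 \<Longrightarrow> norm (f z - p z) < e"
    using Stone_Weierstrass_polynomial_function[OF _ assms] by auto
  have "real_polynomial_function (Re \<circ> p)" "real_polynomial_function (Im \<circ> p)"
    using p by (auto simp: polynomial_function_def bounded_linear_Re bounded_linear_Im)
  from this[THEN trig_poly_of_real_polynomial]
  have "trig_poly (\<lambda>t. of_real ((Re \<circ> p) (cis t)) + \<i> * of_real ((Im \<circ> p) (cis t)))"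
    by (intro trig_poly.add trig_poly.scale)
  moreover have "(\<lambda>t. of_real ((Re \<circ> p) (cis t)) + \<i> * of_real ((Im \<circ> p) (cis t))) = (\<lambda>t. p (cis t))"
    by (auto simp: fun_eq_iff complex_eq_iff)
  ultimately have "trig_poly (\<lambda>t. p (cis t))" by simp
  moreover have "norm (f (cis t) - p (cis t)) < e" for t
    by (rule close) simp
  ultimately show ?thesis by (rule that)
qed

section \<open>Weak limits of densities on the circle\<close>

text \<open>Reduction of an angle modulo \<open>2 * pi\<close>. It carries a measure on the line to one on
\<open>{0..<2*pi}\<close> without changing the integrals of functions of \<open>cis t\<close>.\<close>

lemma measurable_reduce_angle:
  "(\<lambda>t::real. 2*pi * frac (t / (2*pi))) \<in> borel \<rightarrow>\<^sub>M restrict_space borel {0..<2*pi}"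
proof (rule measurable_restrict_space2)
  show "(\<lambda>t::real. 2*pi * frac (t / (2*pi))) \<in> space borel \<rightarrow> {0..<2*pi}"
    using frac_lt_1 by auto
  show "(\<lambda>t::real. 2*pi * frac (t / (2*pi))) \<in> borel_measurable borel"
    unfolding frac_def by measurable
qed

lemma cis_reduce_angle: "cis (2*pi * frac (t / (2*pi))) = cis t"
proof -
  have "2*pi * frac (t / (2*pi)) = t - 2*pi * of_int \<lfloor>t / (2*pi)\<rfloor>"
    by (simp add: frac_def right_diff_distrib)
  then show ?thesis
    using cis_multiple_2pi[of "of_int \<lfloor>t / (2*pi)\<rfloor>"] by (simp flip: cis_divide)
qed

text \<open>Probability densities on the circle whose Fourier coefficients all converge have a weak limit.
As measures on the line they all live on a bounded interval, so they are tight and by Helly's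
selection theorem a subsequence converges weakly to some measure. On the other hand the
integrals of each continuous function on the circle converge along the whole sequence: this is
true for trigonometric polynomials by assumption, and it passes to uniform limits since the
functionals have norm at most one. So the subsequential limit is the limit. Helly's theorem may
leave a mass at the endpoint \<open>2 * pi\<close>; reducing angles moves it to \<open>0\<close>.\<close>

lemma weak_limit_of_densities:
  fixes w :: "nat \<Rightarrow> real \<Rightarrow> real"
  assumes cont: "\<And>N. continuous_on UNIV (w N)" and nn: "\<And>N t. 0 \<le> w N t"
    and mass: "\<And>N. (LINT t:{0..<2*pi}|lborel. w N t) = 1"
    and moments: "\<And>k::int. convergent (\<lambda>N. LINT t:{0..<2*pi}|lborel. w N t *\<^sub>R cis (of_int k * t))"
  obtains M where "finite_measure M" "sets M = sets (restrict_space borel {0..<2*pi})"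
    "\<And>f :: complex \<Rightarrow> complex. continuous_on (sphere 0 1) f \<Longrightarrow>
      (\<lambda>N. LINT t:{0..<2*pi}|lborel. w N t *\<^sub>R f (cis t)) \<longlonglongrightarrow> (LINT t|M. f (cis t))"
proof -
  have [measurable]: "w N \<in> borel_measurable borel" for N
    using cont by (rule borel_measurable_continuous_onI)
  define L where "L N g = (LINT t:{0..<2*pi}|lborel. w N t *\<^sub>R g t)" for N and g :: "real \<Rightarrow> complex"
  have int: "set_integrable lborel {0..<2*pi} (\<lambda>t. w N t *\<^sub>R g t)" if "continuous_on UNIV g"
    for N and g :: "real \<Rightarrow> complex"
    using that cont by (intro set_integrable_circle continuous_intros)
  have L_trig: "convergent (\<lambda>N. L N h)" if "trig_poly h" for h
    using that
  proof (induction rule: trig_poly.induct)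
    case (character k)
    show ?case using moments unfolding L_def .
  next
    case (add f g)
    then have "L N (\<lambda>t. f t + g t) = L N f + L N g" for N
      unfolding L_def by (simp add: scaleR_add_right int continuous_on_trig_poly)
    then show ?case using add by (simp add: convergent_add)
  next
    case (scale f c)
    then have "L N (\<lambda>t. c * f t) = c * L N f" for N
      unfolding L_def by (simp flip: set_integral_mult_right)
    then show ?case using scale by (simp add: convergent_mult convergent_const)
  qed
  have L_close: "norm (L N g - L N h) \<le> e"
    if "continuous_on UNIV g" "continuous_on UNIV h" "\<And>t. norm (g t - h t) < e" for N g h e
  proof -
    have eq: "L N g - L N h = (LINT t:{0..<2*pi}|lborel. w N t *\<^sub>R (g t - h t))"
      unfolding L_def using that(1,2) by (simp add: scaleR_diff_right int)
    have "norm (L N g - L N h) \<le> (LINT t:{0..<2*pi}|lborel. norm (w N t *\<^sub>R (g t - h t)))"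
      unfolding eq using that(1,2) by (intro set_integral_norm_bound int continuous_intros)
    also have "\<dots> \<le> (LINT t:{0..<2*pi}|lborel. w N t * e)"
    proof (rule set_integral_mono)
      show "set_integrable lborel {0..<2*pi} (\<lambda>t. norm (w N t *\<^sub>R (g t - h t)))"
        "set_integrable lborel {0..<2*pi} (\<lambda>t. w N t * e)"
        using that(1,2) cont by (intro set_integrable_circle continuous_intros; simp)+
      show "norm (w N t *\<^sub>R (g t - h t)) \<le> w N t * e" for t
        using nn[of N t] that(3)[of t] by (simp add: mult_left_mono less_imp_le)
    qed
    also have "\<dots> = e"
      using mass[of N] by simp
    finally show ?thesis .
  qed
  \<comment> \<open>An \<open>e/3\<close>-argument with a trigonometric polynomial \<open>h\<close>.\<close>
  have L_conv: "convergent (\<lambda>N. L N (\<lambda>t. f (cis t)))"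
    if f: "continuous_on (sphere 0 1) f" for f
  proof (rule Cauchy_convergent, rule metric_CauchyI)
    fix e :: real assume "0 < e"
    then have "0 < e / 3" by simp
    obtain h where h: "trig_poly h" "\<And>t. norm (f (cis t) - h t) < e / 3"
      using trig_poly_dense[OF f \<open>0 < e / 3\<close>] by blast
    have "continuous_on UNIV (\<lambda>t. f (cis t))"
      using f by (rule continuous_on_compose_cis)
    then have close: "norm (L N (\<lambda>t. f (cis t)) - L N h) \<le> e / 3" for N
      using h by (intro L_close continuous_on_trig_poly[OF h(1)])
    obtain K where K: "\<And>m n. m \<ge> K \<Longrightarrow> n \<ge> K \<Longrightarrow> dist (L m h) (L n h) < e / 3"
      using metric_CauchyD[OF convergent_Cauchy[OF L_trig[OF h(1)]] \<open>0 < e / 3\<close>] by blast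
    have "dist (L m (\<lambda>t. f (cis t))) (L n (\<lambda>t. f (cis t))) < e" if "m \<ge> K" "n \<ge> K" for m n
      using close[of m] close[of n] K[OF that] unfolding dist_norm by norm
    then show "\<exists>K. \<forall>m\<ge>K. \<forall>n\<ge>K. dist (L m (\<lambda>t. f (cis t))) (L n (\<lambda>t. f (cis t))) < e"
      by blast
  qed
  define \<mu> where "\<mu> N = density lborel (\<lambda>t. ennreal (indicator {0..<2*pi} t * w N t))" for N
  have em: "emeasure (\<mu> N) A = 1" if A[measurable]: "A \<in> sets borel" and sub: "{0..<2*pi} \<subseteq> A" for N A
  proof -
    have "emeasure (\<mu> N) A = (\<integral>\<^sup>+t. ennreal (indicator {0..<2*pi} t * w N t) \<partial>lborel)"
      unfolding \<mu>_def using sub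
      by (subst emeasure_density) (auto intro!: nn_integral_cong split: split_indicator)
    also have "\<dots> = ennreal (LINT t|lborel. indicator {0..<2*pi} t * w N t)"
      using set_integrable_circle[OF cont[of N]] nn
      by (intro nn_integral_eq_integral) (auto simp: set_integrable_def)
    also have "\<dots> = 1"
      using mass[of N] by (simp add: set_lebesgue_integral_def)
    finally show ?thesis .
  qed
  have L_eq: "(LINT t|\<mu> N. g t) = L N g" if [measurable]: "g \<in> borel_measurable borel" for N g
    unfolding \<mu>_def L_def set_lebesgue_integral_def using nn
    by (subst integral_density) auto
  have distr: "real_distribution (\<mu> N)" for N
    by (auto simp: real_distribution_def real_distribution_axioms_def \<mu>_def[symmetric]
        intro!: prob_spaceI em) (auto simp: \<mu>_def)
  \<comment> \<open>Tightness asks for an interval that is open on the left, so it has to start below \<open>0\<close>.\<close>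
  have "measure (\<mu> N) {- 1<..2*pi} = 1" for N
    using em[of "{- 1<..2*pi}" N] by (simp add: measure_def subset_eq)
  moreover have "- 1 < 2*pi"
    using pi_gt_zero by linarith
  ultimately have "tight \<mu>"
    unfolding tight_def using distr by (intro conjI allI impI exI[of _ "-1"] exI[of _ "2*pi"]) auto
  then obtain r M\<^sub>0 where r: "strict_mono r" and M\<^sub>0: "real_distribution M\<^sub>0" "weak_conv_m (\<mu> \<circ> r) M\<^sub>0"
    using tight_imp_convergent_subsubsequence[of \<mu> id] by (auto simp: strict_mono_id)
  interpret M\<^sub>0: real_distribution M\<^sub>0 by fact
  define M where "M = distr M\<^sub>0 (restrict_space borel {0..<2*pi}) (\<lambda>t. 2*pi * frac (t / (2*pi)))"
  have red: "(\<lambda>t::real. 2*pi * frac (t / (2*pi))) \<in> M\<^sub>0 \<rightarrow>\<^sub>M restrict_space borel {0..<2*pi}"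
    using measurable_reduce_angle by simp
  show ?thesis
  proof (rule that)
    show "finite_measure M"
      unfolding M_def using red by (rule M\<^sub>0.finite_measure_distr)
    show "sets M = sets (restrict_space borel {0..<2*pi})"
      by (simp add: M_def)
  next
    fix f :: "complex \<Rightarrow> complex" assume f: "continuous_on (sphere 0 1) f"
    have g: "continuous_on UNIV (\<lambda>t. f (cis t))"
      using f by (rule continuous_on_compose_cis)
    then have [measurable]: "(\<lambda>t. f (cis t)) \<in> borel_measurable borel"
      by (rule borel_measurable_continuous_onI)
    have "bounded (f ` sphere 0 1)"
      using f by (intro compact_imp_bounded compact_continuous_image) auto
    then obtain B where "\<And>z. z \<in> sphere 0 1 \<Longrightarrow> norm (f z) \<le> B"
      unfolding bounded_iff by (metis imageI)
    then have B: "norm (f (cis t)) \<le> B" for t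
      by simp
    have "(\<lambda>n. LINT t|(\<mu> \<circ> r) n. f (cis t)) \<longlonglongrightarrow> (LINT t|M\<^sub>0. f (cis t))"
      using g B by (intro weak_conv_imp_integral_bdd_continuous_conv[OF _ M\<^sub>0])
        (auto simp: continuous_on_eq_continuous_at distr)
    then have sub: "((\<lambda>N. L N (\<lambda>t. f (cis t))) \<circ> r) \<longlonglongrightarrow> (LINT t|M\<^sub>0. f (cis t))"
      by (simp add: L_eq o_def)
    obtain l where l: "(\<lambda>N. L N (\<lambda>t. f (cis t))) \<longlonglongrightarrow> l"
      using L_conv[OF f] by (auto simp: convergent_def)
    from LIMSEQ_subseq_LIMSEQ[OF l r] sub have "l = (LINT t|M\<^sub>0. f (cis t))"
      by (rule LIMSEQ_unique)
    also have "\<dots> = (LINT t|M. f (cis t))"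
      unfolding M_def using red
      by (subst integral_distr) (auto simp: cis_reduce_angle intro: measurable_restrict_space1)
    finally show "(\<lambda>N. LINT t:{0..<2*pi}|lborel. w N t *\<^sub>R f (cis t)) \<longlonglongrightarrow> (LINT t|M. f (cis t))"
      using l by (simp add: L_def)
  qed
qed

section \<open>Complex inner products\<close>

lemma cinner_add_right: "cinner x (y + z) = cinner x y + cinner x z"
  using cinner_commute[of x "y + z"] cinner_commute[of x y] cinner_commute[of x z]
  by (simp add: cinner_add_left)

lemma cinner_scaleC_right: "cinner x (a *\<^sub>C y) = cnj a * cinner x y"
  using cinner_commute[of x "a *\<^sub>C y"] cinner_commute[of x y] by (simp add: cinner_scaleC_left)

lemma cinner_zero_left: "cinner 0 y = 0"
  using cinner_add_left[of 0 0 y] by simp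

lemma cinner_zero_right: "cinner y 0 = 0"
  using cinner_add_right[of y 0 0] by simp

lemma cinner_sum_left: "cinner (\<Sum>i\<in>I. g i) y = (\<Sum>i\<in>I. cinner (g i) y)"
  by (induction I rule: infinite_finite_induct) (simp_all add: cinner_zero_left cinner_add_left)

lemma cinner_sum_right: "cinner y (\<Sum>i\<in>I. g i) = (\<Sum>i\<in>I. cinner y (g i))"
  by (induction I rule: infinite_finite_induct) (simp_all add: cinner_zero_right cinner_add_right)

lemma scaleC_zero_right: "a *\<^sub>C (0::'a::complex_inner) = 0"
  using scaleC_add_right[of a 0 "0::'a"] by simp

lemma scaleC_sum_right: "a *\<^sub>C (\<Sum>i\<in>I. g i) = (\<Sum>i\<in>I. a *\<^sub>C (g i :: 'a::complex_inner))"
  by (induction I rule: infinite_finite_induct) (simp_all add: scaleC_zero_right scaleC_add_right)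

lemma cinner_self: "cinner x x = of_real ((norm x)\<^sup>2)"
  using cinner_commute[of x x] cinner_ge_zero[of x]
  by (simp add: norm_eq_sqrt_cinner complex_eq_iff)

lemma cinner_polarization:
  "cinner a b = 1 / 4 * (cinner (a + 1 *\<^sub>C b) (a + 1 *\<^sub>C b) - cinner (a + (- 1) *\<^sub>C b) (a + (- 1) *\<^sub>C b))
    + \<i> / 4 * (cinner (a + \<i> *\<^sub>C b) (a + \<i> *\<^sub>C b) - cinner (a + (- \<i>) *\<^sub>C b) (a + (- \<i>) *\<^sub>C b))"
  by (simp add: cinner_add_left cinner_add_right cinner_scaleC_left cinner_scaleC_right field_simps)

section \<open>Ergodic averages of a unitary operator\<close>

text \<open>Counts the terms that survive in the \<open>k\<close>-th Fourier coefficient of a double sum over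
\<open>{0..N}\<close>. Truncated subtraction gives the correct value \<open>0\<close> when \<open>\<bar>k\<bar> > N\<close>.\<close>

lemma card_diagonal:
  "card {p \<in> {0..N} \<times> {0..N}. int (fst p) - int (snd p) = k} = N + 1 - nat \<bar>k\<bar>"
proof (cases "0 \<le> k")
  case True
  then have "{p \<in> {0..N} \<times> {0..N}. int (fst p) - int (snd p) = k} = (\<lambda>m. (m + nat k, m)) ` {..<N + 1 - nat k}"
    by (force simp: image_iff)
  then show ?thesis using True by (simp add: card_image inj_on_def)
next
  case False
  then have "{p \<in> {0..N} \<times> {0..N}. int (fst p) - int (snd p) = k} = (\<lambda>n. (n, n + nat (- k))) ` {..<N + 1 - nat (- k)}"
    by (force simp: image_iff)
  then show ?thesis using False by (simp add: card_image inj_on_def)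
qed

context
  fixes U :: "'a::chilbert_space \<Rightarrow> 'a"
  assumes U: "unitary_op U"
begin

lemma unitary_op_add: "U (x + y) = U x + U y"
  and unitary_op_scaleC: "U (c *\<^sub>C x) = c *\<^sub>C U x"
  and unitary_op_cinner: "cinner (U x) (U y) = cinner x y"
  using U by (auto simp: unitary_op_def clinear_op_def)

lemma unitary_op_funpow_lin: "(U ^^ n) (x + c *\<^sub>C y) = (U ^^ n) x + c *\<^sub>C (U ^^ n) y"
  by (induction n) (simp_all add: unitary_op_add unitary_op_scaleC)

lemma unitary_op_funpow_cinner: "cinner ((U ^^ n) x) ((U ^^ n) y) = cinner x y"
  by (induction n) (simp_all add: unitary_op_cinner)

lemma T_op_lin: "T_op U N t (x + c *\<^sub>C y) = T_op U N t x + c *\<^sub>C T_op U N t y"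
  by (simp add: T_op_def unitary_op_funpow_lin scaleC_add_right sum.distrib scaleC_sum_right
      scaleC_scaleC mult.commute)

text \<open>The integrand is itself a trigonometric polynomial. This yields both its continuity in \<open>t\<close> and its
Fourier coefficients.\<close>

lemma cinner_T_op:
  "cinner (T_op U N t x) (T_op U N t y) =
    (\<Sum>n=0..N. \<Sum>m=0..N. cis (of_int (int m - int n) * t) * cinner ((U ^^ n) x) ((U ^^ m) y))"
proof -
  have e: "exp (- \<i> * of_real t * of_nat n) = cis (- (of_nat n * t))" for n
    by (simp add: cis_conv_exp mult_ac)
  have "cinner (cis (- (of_nat n * t)) *\<^sub>C (U ^^ n) x) (cis (- (of_nat m * t)) *\<^sub>C (U ^^ m) y)
      = cis (of_int (int m - int n) * t) * cinner ((U ^^ n) x) ((U ^^ m) y)" for n m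
    by (simp add: cinner_scaleC_left cinner_scaleC_right cis_cnj cis_mult left_diff_distrib flip: mult.assoc)
  then show ?thesis
    unfolding T_op_def e cinner_sum_left unfolding cinner_sum_right by simp
qed

lemma continuous_on_cinner_T_op: "continuous_on A (\<lambda>t. cinner (T_op U N t x) (T_op U N t y))"
  unfolding cinner_T_op by (intro continuous_intros)

text \<open>This is \<open>\<langle>U\<^sup>k x, y\<rangle>\<close> for an arbitrary integer \<open>k\<close>; the negative powers of \<open>U\<close> are
moved to the other side, where they become positive powers.\<close>

definition fourier_coeff :: "int \<Rightarrow> 'a \<Rightarrow> 'a \<Rightarrow> complex" where
  "fourier_coeff k x y = (if 0 \<le> k then cinner ((U ^^ nat k) x) y else cinner x ((U ^^ nat (- k)) y))"

lemma cinner_funpow_eq_fourier_coeff: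
  "cinner ((U ^^ n) x) ((U ^^ m) y) = fourier_coeff (int n - int m) x y"
proof (cases "m \<le> n")
  case True
  then obtain j where "n = m + j" by (auto simp: le_iff_add)
  then show ?thesis by (simp add: fourier_coeff_def funpow_add unitary_op_funpow_cinner)
next
  case False
  then obtain j where "m = n + j" "j > 0" by (auto simp: not_le less_iff_Suc_add)
  then show ?thesis by (simp add: fourier_coeff_def funpow_add unitary_op_funpow_cinner)
qed

text \<open>The inner products \<open>\<langle>U\<^sup>n x, U\<^sup>m y\<rangle>\<close> depend on \<open>n - m\<close> only, by unitarity. By
orthogonality of the characters, the integral keeps the terms with \<open>n - m = k\<close>, all of which are equal.
After division by \<open>N + 1\<close> this shows Fejer weights \<open>1 - \<bar>k\<bar> / (N + 1)\<close>, which tend to \<open>1\<close>.\<close>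

lemma integral_cinner_T_op_character:
  "(LINT t:{0..<2*pi}|lborel. cinner (T_op U N t x) (T_op U N t y) * cis (of_int k * t))
    = 2 * of_real pi * of_nat (N + 1 - nat \<bar>k\<bar>) * fourier_coeff k x y"
proof -
  have int: "set_integrable lborel {0..<2*pi} (\<lambda>t. c * cis (of_int l * t))" for c l
    by (intro set_integrable_circle continuous_intros)
  have "(LINT t:{0..<2*pi}|lborel. cinner (T_op U N t x) (T_op U N t y) * cis (of_int k * t))
      = (LINT t:{0..<2*pi}|lborel. \<Sum>p\<in>{0..N} \<times> {0..N}.
          fourier_coeff (int (fst p) - int (snd p)) x y * cis (of_int (k - (int (fst p) - int (snd p))) * t))"
  proof (rule arg_cong[of _ _ "set_lebesgue_integral lborel {0..<2*pi}"], rule ext)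
    fix t
    have "cis (of_int (int m - int n) * t) * c * cis (of_int k * t) = c * cis (of_int (k - (int n - int m)) * t)" for n m c
      using cis_mult[of "of_int (int m - int n) * t" "of_int k * t"]
      by (simp only: mult.assoc mult.left_commute[of _ c]) (simp add: algebra_simps)
    then show "cinner (T_op U N t x) (T_op U N t y) * cis (of_int k * t) = (\<Sum>p\<in>{0..N} \<times> {0..N}.
          fourier_coeff (int (fst p) - int (snd p)) x y * cis (of_int (k - (int (fst p) - int (snd p))) * t))"
      unfolding cinner_T_op cinner_funpow_eq_fourier_coeff sum.cartesian_product case_prod_unfold sum_distrib_right
      by (intro sum.cong refl)
  qed
  also have "\<dots> = (\<Sum>p\<in>{0..N} \<times> {0..N}. LINT t:{0..<2*pi}|lborel.
          fourier_coeff (int (fst p) - int (snd p)) x y * cis (of_int (k - (int (fst p) - int (snd p))) * t))"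
    unfolding set_lebesgue_integral_def scaleR_sum_right
    by (rule Bochner_Integration.integral_sum) (rule int[unfolded set_integrable_def])
  also have "\<dots> = (\<Sum>p\<in>{0..N} \<times> {0..N}. if int (fst p) - int (snd p) = k then 2 * of_real pi * fourier_coeff k x y else 0)"
    by (intro sum.cong refl) (simp only: set_integral_mult_right integral_character, auto)
  also have "\<dots> = 2 * of_real pi * of_nat (N + 1 - nat \<bar>k\<bar>) * fourier_coeff k x y"
    by (subst sum.inter_filter[symmetric]) (simp_all only: sum_constant card_diagonal, auto)
  finally show ?thesis .
qed

lemma F_functional_polarization:
  assumes f: "continuous_on (sphere 0 1) f"
  shows "F_functional U x y N f =
    1 / 4 * (F_functional U (x + 1 *\<^sub>C y) (x + 1 *\<^sub>C y) N f - F_functional U (x + (- 1) *\<^sub>C y) (x + (- 1) *\<^sub>C y) N f)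
    + \<i> / 4 * (F_functional U (x + \<i> *\<^sub>C y) (x + \<i> *\<^sub>C y) N f - F_functional U (x + (- \<i>) *\<^sub>C y) (x + (- \<i>) *\<^sub>C y) N f)"
proof -
  define I where "I u v = (LINT t:{0..<2*pi}|lborel. cinner (T_op U N t u) (T_op U N t v) * f (exp (\<i> * of_real t)))" for u v
  have int: "set_integrable lborel {0..<2*pi} (\<lambda>t. c * (cinner (T_op U N t u) (T_op U N t v) * f (exp (\<i> * of_real t))))" for c u v
    by (intro set_integrable_circle continuous_intros continuous_on_cinner_T_op continuous_on_compose2[OF f])
      (auto simp: norm_exp_i_times)
  note int1 = int[of 1, unfolded mult_1_left]
  have "cinner (T_op U N t x) (T_op U N t y) * f (exp (\<i> * of_real t)) =
    1 / 4 * (cinner (T_op U N t (x + 1 *\<^sub>C y)) (T_op U N t (x + 1 *\<^sub>C y)) * f (exp (\<i> * of_real t))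
      - cinner (T_op U N t (x + (- 1) *\<^sub>C y)) (T_op U N t (x + (- 1) *\<^sub>C y)) * f (exp (\<i> * of_real t)))
    + \<i> / 4 * (cinner (T_op U N t (x + \<i> *\<^sub>C y)) (T_op U N t (x + \<i> *\<^sub>C y)) * f (exp (\<i> * of_real t))
      - cinner (T_op U N t (x + (- \<i>) *\<^sub>C y)) (T_op U N t (x + (- \<i>) *\<^sub>C y)) * f (exp (\<i> * of_real t)))" for t
    unfolding T_op_lin by (subst cinner_polarization) (simp only: ring_distribs mult.assoc)
  then have "I x y = 1 / 4 * (I (x + 1 *\<^sub>C y) (x + 1 *\<^sub>C y) - I (x + (- 1) *\<^sub>C y) (x + (- 1) *\<^sub>C y))
    + \<i> / 4 * (I (x + \<i> *\<^sub>C y) (x + \<i> *\<^sub>C y) - I (x + (- \<i>) *\<^sub>C y) (x + (- \<i>) *\<^sub>C y))"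
    unfolding I_def
    by (simp only: set_integral_add(2) set_integral_diff set_integral_mult_right int int1 set_integrable_mult_right)
  then show ?thesis
    unfolding F_functional_def I_def[symmetric] by (simp only: ring_distribs mult_ac)
qed

text \<open>On the diagonal \<open>x = y\<close> the functional is integration against the nonnegative density
\<open>\<parallel>T\<^sub>N(t) x\<parallel>\<^sup>2 / (2\<pi>(N + 1))\<close>. Its zeroth Fourier coefficient shows that its mass is
\<open>\<parallel>x\<parallel>\<^sup>2\<close> for every \<open>N\<close>. For \<open>x \<noteq> 0\<close> it is therefore normalized to the probability
density \<open>w\<close>, and the limit measure is rescaled at the end.\<close>

lemma positive_spectral_measure:
  obtains M where "finite_measure M" "sets M = sets (restrict_space borel {0..<2*pi})"
    "\<And>f. continuous_on (sphere 0 1) f \<Longrightarrow>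
      (\<lambda>N. F_functional U x x N f) \<longlonglongrightarrow> (LINT t|M. f (exp (\<i> * of_real t)))"
proof (cases "x = 0")
  case True
  have "(U ^^ n) 0 = 0" for n
    using unitary_op_funpow_cinner[of n 0 0] by (simp add: cinner_eq_zero_iff cinner_zero_left)
  then have "F_functional U x x N f = 0" for N f
    using True by (simp add: F_functional_def T_op_def scaleC_zero_right cinner_zero_left)
  moreover have "finite_measure (null_measure (restrict_space borel {0..<2*pi}))"
    by (intro finite_measureI) simp
  moreover have "(LINT t|null_measure (restrict_space borel {0..<2*pi}). f t) = (0::complex)" for f :: "real \<Rightarrow> complex"
    by (simp add: integral_eq_zero_AE eventually_ae_filter)
  ultimately show ?thesis
    by (intro that[of "null_measure (restrict_space borel {0..<2*pi})"]) simp_all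
next
  case False
  define w where "w N t = (norm (T_op U N t x))\<^sup>2 / (2 * pi * (of_nat N + 1) * (norm x)\<^sup>2)" for N t
  have K: "cinner (T_op U N t x) (T_op U N t x) = of_real (w N t * (2 * pi * (of_nat N + 1) * (norm x)\<^sup>2))" for N t
    using False by (simp add: cinner_self w_def del: of_nat_Suc)
  have cx: "of_real (w N t) = cinner (T_op U N t x) (T_op U N t x) / of_real (2 * pi * (of_nat N + 1) * (norm x)\<^sup>2)" for N t
    by (simp add: cinner_self w_def)
  have moment: "(LINT t:{0..<2*pi}|lborel. w N t *\<^sub>R cis (of_int k * t))
      = of_nat (N + 1 - nat \<bar>k\<bar>) / of_nat (N + 1) * (fourier_coeff k x x / of_real ((norm x)\<^sup>2))" for N k
  proof -
    have "(LINT t:{0..<2*pi}|lborel. w N t *\<^sub>R cis (of_int k * t))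
      = (LINT t:{0..<2*pi}|lborel. 1 / of_real (2 * pi * (of_nat N + 1) * (norm x)\<^sup>2) * (cinner (T_op U N t x) (T_op U N t x) * cis (of_int k * t)))"
      by (simp add: scaleR_conv_of_real cx)
    also have "\<dots> = 1 / of_real (2 * pi * (of_nat N + 1) * (norm x)\<^sup>2) * (2 * of_real pi * of_nat (N + 1 - nat \<bar>k\<bar>) * fourier_coeff k x x)"
      by (simp only: set_integral_mult_right integral_cinner_T_op_character)
    also have "\<dots> = of_nat (N + 1 - nat \<bar>k\<bar>) / of_nat (N + 1) * (fourier_coeff k x x / of_real ((norm x)\<^sup>2))"
      by (simp add: add.commute)
    finally show ?thesis .
  qed
  obtain M where M: "finite_measure M" "sets M = sets (restrict_space borel {0..<2*pi})"
    and lim: "\<And>f :: complex \<Rightarrow> complex. continuous_on (sphere 0 1) f \<Longrightarrow>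
      (\<lambda>N. LINT t:{0..<2*pi}|lborel. w N t *\<^sub>R f (cis t)) \<longlonglongrightarrow> (LINT t|M. f (cis t))"
  proof (rule weak_limit_of_densities[of w])
    have "w N = (\<lambda>t. Re (cinner (T_op U N t x) (T_op U N t x)) / (2 * pi * (of_nat N + 1) * (norm x)\<^sup>2))" for N
      by (auto simp: w_def cinner_self)
    then show "continuous_on UNIV (w N)" for N
      using False by (auto intro!: continuous_intros continuous_on_cinner_T_op)
    show "0 \<le> w N t" for N t
      by (simp add: w_def)
    show "(LINT t:{0..<2*pi}|lborel. w N t) = 1" for N
    proof -
      have "of_real (LINT t:{0..<2*pi}|lborel. w N t) = (LINT t:{0..<2*pi}|lborel. w N t *\<^sub>R cis (of_int 0 * t))"
        by (simp add: set_lebesgue_integral_def scaleR_conv_of_real flip: integral_complex_of_real of_real_mult)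
      also have "\<dots> = 1"
        unfolding moment using False by (simp add: fourier_coeff_def cinner_self del: of_nat_Suc)
      finally show ?thesis by (simp only: of_real_eq_1_iff)
    qed
    show "convergent (\<lambda>N. LINT t:{0..<2*pi}|lborel. w N t *\<^sub>R cis (of_int k * t))" for k :: int
    proof -
      have "(\<lambda>N. real (N + 1 - nat \<bar>k\<bar>) / real (N + 1)) \<longlonglongrightarrow> 1"
      proof (rule Lim_transform_eventually)
        show "(\<lambda>N. 1 - real (nat \<bar>k\<bar>) * inverse (real (Suc N))) \<longlonglongrightarrow> 1"
          using tendsto_diff[OF tendsto_const tendsto_mult[OF tendsto_const LIMSEQ_inverse_real_of_nat], of 1 "real (nat \<bar>k\<bar>)"] by simp
        show "\<forall>\<^sub>F N in sequentially. 1 - real (nat \<bar>k\<bar>) * inverse (real (Suc N)) = real (N + 1 - nat \<bar>k\<bar>) / real (N + 1)"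
          using eventually_ge_at_top[of "nat \<bar>k\<bar>"]
          by eventually_elim (simp add: of_nat_diff field_simps)
      qed
      then have "(\<lambda>N. complex_of_real (real (N + 1 - nat \<bar>k\<bar>) / real (N + 1))) \<longlonglongrightarrow> of_real 1"
        by (rule tendsto_of_real)
      then have "(\<lambda>N. complex_of_nat (N + 1 - nat \<bar>k\<bar>) / of_nat (N + 1)) \<longlonglongrightarrow> 1"
        by simp
      then show ?thesis
        unfolding moment convergent_def by (intro exI) (rule tendsto_mult_right)
    qed
  qed blast
  define M' where "M' = density M (\<lambda>_. ennreal ((norm x)\<^sup>2))"
  show ?thesis
  proof (rule that)
    interpret finite_measure M by fact
    show "finite_measure M'"
      unfolding M'_def by (intro finite_measureI) (simp add: emeasure_density ennreal_mult_eq_top_iff)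
    show "sets M' = sets (restrict_space borel {0..<2*pi})"
      using M(2) by (simp add: M'_def)
    fix f :: "complex \<Rightarrow> complex" assume f: "continuous_on (sphere 0 1) f"
    have g: "continuous_on UNIV (\<lambda>t. f (cis t))"
      using f by (rule continuous_on_compose_cis)
    have meas: "(\<lambda>t. f (cis t)) \<in> borel_measurable M"
      using borel_measurable_continuous_onI[OF g] measurable_restrict_space1
      by (subst measurable_cong_sets[OF M(2) refl]) auto
    have "F_functional U x x N f = (norm x)\<^sup>2 *\<^sub>R (LINT t:{0..<2*pi}|lborel. w N t *\<^sub>R f (cis t))" for N
    proof -
      have "(LINT t:{0..<2*pi}|lborel. cinner (T_op U N t x) (T_op U N t x) * f (exp (\<i> * of_real t)))
          = (LINT t:{0..<2*pi}|lborel. of_real (2 * pi * (of_nat N + 1) * (norm x)\<^sup>2) * (w N t *\<^sub>R f (cis t)))"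
        unfolding K by (simp add: cis_conv_exp scaleR_conv_of_real mult_ac)
      also have "\<dots> = of_real (2 * pi * (of_nat N + 1) * (norm x)\<^sup>2) * (LINT t:{0..<2*pi}|lborel. w N t *\<^sub>R f (cis t))"
        by (rule set_integral_mult_right)
      finally show ?thesis
        unfolding F_functional_def
        using of_nat_neq_0[of N, where 'a=complex] by (simp add: scaleR_conv_of_real add.commute)
    qed
    moreover have "(LINT t|M'. f (exp (\<i> * of_real t))) = (norm x)\<^sup>2 *\<^sub>R (LINT t|M. f (cis t))"
      unfolding M'_def cis_conv_exp[symmetric] using meas by (subst integral_density) auto
    ultimately show "(\<lambda>N. F_functional U x x N f) \<longlonglongrightarrow> (LINT t|M'. f (exp (\<i> * of_real t)))"
      using lim[OF f] by (simp add: tendsto_scaleR)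
  qed
qed

end

section \<open>The complex limit measure\<close>

theorem theorem2p1:
  fixes U :: "'a::chilbert_space \<Rightarrow> 'a" and x y :: 'a
  assumes "unitary_op U"
  shows "\<exists>\<mu> :: real set \<Rightarrow> complex.
    complex_measure (restrict_space borel {0..<2*pi}) \<mu> \<and>
    (\<forall>f :: complex \<Rightarrow> complex. continuous_on (sphere 0 1) f \<longrightarrow>
      (\<lambda>N. F_functional U x y N f) \<longlonglongrightarrow>
        complex_measure_integral (restrict_space borel {0..<2*pi}) \<mu>
          (\<lambda>t. f (exp (\<i> * of_real t))))"
proof -
  let ?X = "restrict_space borel {0..<2*pi} :: real measure"
  have "\<exists>M. \<forall>z. finite_measure (M z) \<and> sets (M z) = sets ?X \<and>
      (\<forall>f. continuous_on (sphere 0 1) f \<longrightarrow>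
        (\<lambda>N. F_functional U z z N f) \<longlonglongrightarrow> (LINT t|M z. f (exp (\<i> * of_real t))))"
    by (rule choice) (metis positive_spectral_measure[OF assms])
  then obtain M where fin: "\<And>z. finite_measure (M z)" and sets: "\<And>z. sets (M z) = sets ?X"
    and lim: "\<And>z f. continuous_on (sphere 0 1) f \<Longrightarrow>
        (\<lambda>N. F_functional U z z N f) \<longlonglongrightarrow> (LINT t|M z. f (exp (\<i> * of_real t)))"
    by blast
  \<comment> \<open>The polarization identity turns the four diagonal limit measures into a complex measure.\<close>
  define P where "P c = M (x + c *\<^sub>C y)" for c
  define \<mu> :: "real set \<Rightarrow> complex" where
    "\<mu> A = of_real (1 / 4 * (measure (P 1) A - measure (P (- 1)) A))
      + \<i> * of_real (1 / 4 * (measure (P \<i>) A - measure (P (- \<i>)) A))" for A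
  have "complex_measure ?X \<mu>"
    unfolding complex_measure_def
  proof (intro conjI allI impI)
    show "\<mu> {} = 0"
      by (simp add: \<mu>_def)
    fix A :: "nat \<Rightarrow> real set" assume A: "range A \<subseteq> sets ?X" "disjoint_family A"
    have "(\<lambda>i. measure (P c) (A i)) sums measure (P c) (\<Union>i. A i)" for c
      unfolding P_def using A sets by (intro finite_measure.finite_measure_UNION[OF fin]) simp_all
    then show "(\<lambda>i. \<mu> (A i)) sums \<mu> (\<Union>i. A i)"
      unfolding \<mu>_def by (intro sums_add sums_mult sums_diff sums_of_real)
  qed
  moreover have "(\<lambda>N. F_functional U x y N f) \<longlonglongrightarrow> complex_measure_integral ?X \<mu> (\<lambda>t. f (exp (\<i> * of_real t)))"
    if f: "continuous_on (sphere 0 1) f" for f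
  proof -
    let ?g = "\<lambda>t::real. f (exp (\<i> * of_real t))"
    have "continuous_on UNIV ?g"
      by (rule continuous_on_compose2[OF f]) (auto intro!: continuous_intros simp: norm_exp_i_times)
    then have meas: "?g \<in> borel_measurable ?X"
      by (intro measurable_restrict_space1 borel_measurable_continuous_onI)
    have "bounded (f ` sphere 0 1)"
      using f by (intro compact_imp_bounded compact_continuous_image) auto
    then obtain B where B: "\<And>z. z \<in> sphere 0 1 \<Longrightarrow> norm (f z) \<le> B"
      unfolding bounded_iff by (metis imageI)
    have signed: "signed_integral ?X \<nu> ?g = (1 / 4) *\<^sub>R ((LINT t|P c. ?g t) - (LINT t|P d. ?g t))"
      if "\<And>A. \<nu> A = 1 / 4 * (measure (P c) A - measure (P d) A)" for \<nu> c d
      using fin sets meas B that unfolding P_def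
      by (intro signed_integral_diff_finite_measures[where B=B]) (auto simp: norm_exp_i_times)
    have "complex_measure_integral ?X \<mu> ?g =
        1 / 4 * ((LINT t|P 1. ?g t) - (LINT t|P (- 1). ?g t)) + \<i> / 4 * ((LINT t|P \<i>. ?g t) - (LINT t|P (- \<i>). ?g t))"
    proof -
      have re: "signed_integral ?X (\<lambda>A. Re (\<mu> A)) ?g = (1 / 4) *\<^sub>R ((LINT t|P 1. ?g t) - (LINT t|P (- 1). ?g t))"
        by (rule signed) (simp add: \<mu>_def)
      have im: "signed_integral ?X (\<lambda>A. Im (\<mu> A)) ?g = (1 / 4) *\<^sub>R ((LINT t|P \<i>. ?g t) - (LINT t|P (- \<i>). ?g t))"
        by (rule signed) (simp add: \<mu>_def)
      show ?thesis
        unfolding complex_measure_integral_def re im scaleR_conv_of_real by simp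
    qed
    moreover have "(\<lambda>N. F_functional U x y N f) \<longlonglongrightarrow>
        1 / 4 * ((LINT t|P 1. ?g t) - (LINT t|P (- 1). ?g t)) + \<i> / 4 * ((LINT t|P \<i>. ?g t) - (LINT t|P (- \<i>). ?g t))"
      unfolding F_functional_polarization[OF assms f, where x=x and y=y] P_def
      by (intro tendsto_add tendsto_mult tendsto_diff tendsto_const lim[OF f])
    ultimately show ?thesis by simp
  qed
  ultimately show ?thesis by blast
qed

end
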